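(* Let $\rho=2\cos(\pi/9)$. Let $G$ be a simple graph having a pendant path of length $t\geq 3$. Then the adjacency matrix $A(G)$ has an eigenvalue in $(1,\rho]$ and an eigenvalue in $[-\rho,-1)$. In particular, $G$ is not integral. Consequently, there is no integral generalized sun graph in which a path $P_t$ with $t\geq 3$ is attached to a cycle vertex.
   Context: Graphs are finite and simple; $A(G)$ denotes the adjacency matrix of $G$. A graph is integral if all eigenvalues of its adjacency matrix are integers. A path $v u_1 u_2\cdots u_t$ in a graph $G$ (with distinct vertices $v,u_1,\dots,u_t$) is a pendant path of length $t$ at $v$ if $\deg_G(u_i)=2$ for $1\leq i\leq t-1$ and $\deg_G(u_t)=1$ (no condition is imposed on $v$). $P_t$ denotes the path on $t$ vertices. Attaching $P_t$ to a vertex $v$ of a graph $H$ means adding $t$ new vertices $u_1,\dots,u_t$ together with the edges $vu_1$ and $u_iu_{i+1}$ for $1\leq i\leq t-1$. A generalized sun graph is a graph obtained from a cycle by attaching paths to vertices of the cycle. *)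

theory Defs
  imports
    Complex_Main
    "Graph_Theory.Pair_Digraph"
    "Graph_Theory.Vertex_Walk"
    "Jordan_Normal_Form.Char_Poly"
begin

text \<open>
  A finite simple graph is a \<^locale>\<open>pair_graph\<close>: each edge \<open>{u, v}\<close> is represented by the two
  arcs \<open>(u, v)\<close> and \<open>(v, u)\<close>, so the degree of a vertex is its \<^const>\<open>out_degree\<close>.
\<close>

definition vertex_ordering :: "'a pair_pre_digraph \<Rightarrow> 'a list \<Rightarrow> bool" where
  "vertex_ordering G xs \<longleftrightarrow> distinct xs \<and> set xs = pverts G"

definition adj_matrix :: "'a pair_pre_digraph \<Rightarrow> 'a list \<Rightarrow> 'b :: zero_neq_one mat" where
  "adj_matrix G xs =
     mat (length xs) (length xs) (\<lambda>(i, j). if (xs ! i, xs ! j) \<in> parcs G then 1 else 0)"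

text \<open>
  The spectrum does not depend on the vertex ordering.  Complex scalars are used so that
  integrality constrains all eigenvalues, without presupposing that they are real.
\<close>
definition integral_graph :: "'a pair_pre_digraph \<Rightarrow> bool" where
  "integral_graph G \<longleftrightarrow>
     (\<forall>xs. vertex_ordering G xs \<longrightarrow> (\<forall>z :: complex. eigenvalue (adj_matrix G xs) z \<longrightarrow> z \<in> \<int>))"

text \<open>
  \<open>pendant_path G v us\<close>: the path \<open>v # us\<close> is a pendant path at \<open>v\<close>, of length \<open>length us\<close>.
\<close>
definition pendant_path :: "'a pair_pre_digraph \<Rightarrow> 'a \<Rightarrow> 'a list \<Rightarrow> bool" where
  "pendant_path G v us \<longleftrightarrow>
     us \<noteq> [] \<and> vpath (v # us) (with_proj G) \<and>
     (\<forall>u \<in> set (butlast us). out_degree (with_proj G) u = 2) \<and>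
     out_degree (with_proj G) (last us) = 1"

definition undirected_arcs :: "'a list \<Rightarrow> 'a rel" where
  "undirected_arcs p = set (vwalk_arcs p) \<union> (set (vwalk_arcs p))\<inverse>"

definition cycle_graph :: "'a list \<Rightarrow> 'a pair_pre_digraph" where
  "cycle_graph cs = \<lparr> pverts = set cs, parcs = undirected_arcs (cs @ [hd cs]) \<rparr>"

definition attach_path :: "'a pair_pre_digraph \<Rightarrow> 'a \<Rightarrow> 'a list \<Rightarrow> 'a pair_pre_digraph" where
  "attach_path G v us =
     \<lparr> pverts = pverts G \<union> set us, parcs = parcs G \<union> undirected_arcs (v # us) \<rparr>"

text \<open>
  \<open>generalized_sun cs ps G\<close>: \<open>G\<close> arises from the cycle on \<open>cs\<close> by attaching, for each pair
  \<open>(v, us)\<close> in \<open>ps\<close>, a path on the new vertices \<open>us\<close> to the cycle vertex \<open>v\<close>.  Several paths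
  may be attached to the same cycle vertex.
\<close>
inductive generalized_sun ::
    "'a list \<Rightarrow> ('a \<times> 'a list) list \<Rightarrow> 'a pair_pre_digraph \<Rightarrow> bool"
  for cs :: "'a list" where
  cycle: "3 \<le> length cs \<Longrightarrow> distinct cs \<Longrightarrow> generalized_sun cs [] (cycle_graph cs)"
| attach: "generalized_sun cs ps G \<Longrightarrow> v \<in> set cs \<Longrightarrow>
     us \<noteq> [] \<Longrightarrow> distinct us \<Longrightarrow> set us \<inter> pverts G = {} \<Longrightarrow>
     generalized_sun cs ((v, us) # ps) (attach_path G v us)"

end

theory Submission
  imports Defs "HOL-Analysis.Function_Topology"
begin

text \<open>
  Let \<open>\<rho> = 2 cos (\<pi> / 9)\<close>, so that \<open>\<rho>\<^sup>3 = 3 \<rho> + 1\<close>, and let \<open>a\<close> (the leaf), \<open>b\<close>, \<open>c\<close> be the last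
  three vertices of the pendant path.  The degree conditions determine \<open>A w\<close> for every \<open>w\<close>
  supported on \<open>{a, b, c}\<close>, and \<open>w = (1 + \<rho>, \<rho>\<^sup>2, \<rho>)\<close> satisfies \<open>\<langle>(A - 1) (A - \<rho>) w, w\<rangle> = 0\<close>
  although \<open>A w \<noteq> w\<close>.  If \<open>A\<close> had no eigenvalue in \<open>(1, \<rho>]\<close>, then \<open>(A - 1) (A - \<rho>)\<close> would be
  positive semidefinite with kernel the eigenspace of \<open>1\<close>, a contradiction.  The negative
  eigenvalue comes from \<open>- A\<close> and \<open>w = (1 + \<rho>, - \<rho>\<^sup>2, \<rho>)\<close>.
\<close>

section \<open>Inner product and linear operators on functions restricted to a finite set\<close>

definition inner_on :: "'a set \<Rightarrow> ('a \<Rightarrow> real) \<Rightarrow> ('a \<Rightarrow> real) \<Rightarrow> real" where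
  "inner_on V x y = (\<Sum>i\<in>V. x i * y i)"

text \<open>Matrices are indexed by the vertices themselves, so the spectral argument needs no
  numbering. The scalar ring is left open because the eigenvalue is found over the reals but
  integrality is tested over the complex numbers.\<close>

definition kernel_map :: "'a set \<Rightarrow> ('a \<Rightarrow> 'a \<Rightarrow> 'b) \<Rightarrow> ('a \<Rightarrow> 'b) \<Rightarrow> 'a \<Rightarrow> 'b :: comm_ring_1" where
  "kernel_map V K x i = (\<Sum>j\<in>V. K i j * x j)"

definition symmetric_on :: "'a set \<Rightarrow> ('a \<Rightarrow> 'a \<Rightarrow> real) \<Rightarrow> bool" where
  "symmetric_on V K \<longleftrightarrow> (\<forall>i\<in>V. \<forall>j\<in>V. K i j = K j i)"

lemma inner_on_commute: "inner_on V x y = inner_on V y x"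
  by (simp add: inner_on_def mult.commute)

lemma inner_on_add_left: "inner_on V (\<lambda>i. x i + y i) z = inner_on V x z + inner_on V y z"
  by (simp add: inner_on_def algebra_simps sum.distrib)

lemma inner_on_diff_left: "inner_on V (\<lambda>i. x i - y i) z = inner_on V x z - inner_on V y z"
  by (simp add: inner_on_def algebra_simps sum_subtractf)

lemma inner_on_scale_left: "inner_on V (\<lambda>i. c * x i) z = c * inner_on V x z"
  by (simp add: inner_on_def algebra_simps sum_distrib_left)

lemma inner_on_add_right: "inner_on V z (\<lambda>i. x i + y i) = inner_on V z x + inner_on V z y"
  by (simp add: inner_on_def algebra_simps sum.distrib)

lemma inner_on_diff_right: "inner_on V z (\<lambda>i. x i - y i) = inner_on V z x - inner_on V z y"
  by (simp add: inner_on_def algebra_simps sum_subtractf)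

lemma inner_on_scale_right: "inner_on V z (\<lambda>i. c * x i) = c * inner_on V z x"
  by (simp add: inner_on_def algebra_simps sum_distrib_left)

lemmas inner_on_bilinear = inner_on_add_left inner_on_diff_left inner_on_scale_left
  inner_on_add_right inner_on_diff_right inner_on_scale_right

lemma inner_on_cong_left: "(\<And>i. i \<in> V \<Longrightarrow> x i = y i) \<Longrightarrow> inner_on V x z = inner_on V y z"
  by (simp add: inner_on_def)

lemma inner_on_nonneg: "0 \<le> inner_on V x x"
  by (simp add: inner_on_def sum_nonneg)

lemma inner_on_eq_0_iff:
  assumes "finite V"
  shows "inner_on V x x = 0 \<longleftrightarrow> (\<forall>i\<in>V. x i = 0)"
  using assms by (simp add: inner_on_def sum_nonneg_eq_0_iff)

lemma kernel_map_add: "kernel_map V K (\<lambda>i. x i + y i) = (\<lambda>i. kernel_map V K x i + kernel_map V K y i)"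
  by (simp add: kernel_map_def fun_eq_iff algebra_simps sum.distrib)

lemma kernel_map_diff: "kernel_map V K (\<lambda>i. x i - y i) = (\<lambda>i. kernel_map V K x i - kernel_map V K y i)"
  by (simp add: kernel_map_def fun_eq_iff algebra_simps sum_subtractf)

lemma kernel_map_scale: "kernel_map V K (\<lambda>i. c * x i) = (\<lambda>i. c * kernel_map V K x i)"
  by (simp add: kernel_map_def fun_eq_iff algebra_simps sum_distrib_left)

lemma inner_on_kernel_map:
  assumes "symmetric_on V K"
  shows "inner_on V (kernel_map V K x) y = inner_on V x (kernel_map V K y)"
proof -
  have "inner_on V (kernel_map V K x) y = (\<Sum>i\<in>V. \<Sum>j\<in>V. K i j * x j * y i)"
    by (simp add: inner_on_def kernel_map_def sum_distrib_right)
  also have "\<dots> = (\<Sum>j\<in>V. \<Sum>i\<in>V. K i j * x j * y i)"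
    by (rule sum.swap)
  also have "\<dots> = (\<Sum>j\<in>V. \<Sum>i\<in>V. x j * (K j i * y i))"
    using assms unfolding symmetric_on_def by (intro sum.cong refl) (simp add: mult_ac)
  also have "\<dots> = inner_on V x (kernel_map V K y)"
    by (simp add: inner_on_def kernel_map_def sum_distrib_left)
  finally show ?thesis .
qed

section \<open>Minimising a quadratic form on the unit sphere\<close>

text \<open>The sphere is a closed subset of a product of the compact sets \<open>{-1..1}\<close>
  (on \<open>V\<close>) and \<open>{0}\<close> (off \<open>V\<close>), compact by Tychonoff.
  Requiring \<open>x\<close> to vanish off \<open>V\<close> bounds the coordinates that
  \<open>inner_on V\<close> does not see.\<close>

lemma compact_unit_sphere_on:
  fixes V :: "'a set"
  assumes fin: "finite V"
  shows "compact {x. (\<forall>i. i \<notin> V \<longrightarrow> x i = 0) \<and> inner_on V x x = 1}" (is "compact ?S")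
proof -
  define B where "B = PiE UNIV (\<lambda>i. if i \<in> V then {-1..1::real} else {0})"
  have "compactin (product_topology (\<lambda>_. euclidean) UNIV) B"
    unfolding B_def by (subst compactin_PiE) auto
  then have "compact B"
    by (simp add: euclidean_product_topology)
  moreover have "continuous_on UNIV (\<lambda>x. inner_on V x x)"
    unfolding inner_on_def by (intro continuous_intros continuous_on_product_coordinates)
  then have "closed ((\<lambda>x. inner_on V x x) -` {1})"
    by (intro closed_vimage) auto
  ultimately have "compact (B \<inter> (\<lambda>x. inner_on V x x) -` {1})"
    by (rule compact_Int_closed)
  moreover have "\<bar>x i\<bar> \<le> 1" if "inner_on V x x = 1" "i \<in> V" for x :: "'a \<Rightarrow> real" and i
  proof -
    have "x i * x i \<le> 1"
      using member_le_sum[of i V "\<lambda>j. x j * x j"] that fin by (simp add: inner_on_def)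
    then show ?thesis
      by (simp add: abs_square_le_1[symmetric] power2_eq_square)
  qed
  then have "?S = B \<inter> (\<lambda>x. inner_on V x x) -` {1}"
    unfolding B_def by (force simp: PiE_iff abs_le_iff split: if_splits)
  ultimately show ?thesis by simp
qed

text \<open>With \<open>k\<close> positive and at least \<open>c\<close>, the choice
  \<open>t = - b / k\<close> bounds the expression above by \<open>- (b\<^sup>2 / k)\<close>, which
  is negative unless \<open>b = 0\<close>.\<close>

lemma linear_coeff_zero_if_nonneg:
  fixes b c :: real
  assumes nonneg: "\<And>t. 0 \<le> 2 * t * b + t\<^sup>2 * c"
  shows "b = 0"
proof (rule ccontr)
  assume "b \<noteq> 0"
  define k where "k = \<bar>c\<bar> + 1"
  have k: "0 < k" "c \<le> k" by (auto simp: k_def)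
  have "0 \<le> 2 * (- b / k) * b + (- b / k)\<^sup>2 * c" by (rule nonneg)
  also have "\<dots> \<le> 2 * (- b / k) * b + (- b / k)\<^sup>2 * k"
    using k by (intro add_left_mono mult_left_mono) auto
  also have "\<dots> = - (b\<^sup>2 / k)"
    using k by (simp add: field_simps power2_eq_square)
  also have "\<dots> < 0" using \<open>b \<noteq> 0\<close> k by simp
  finally show False by simp
qed

text \<open>First-order condition for \<open>K - m\<close>, which is positive semidefinite and whose
  form vanishes at \<open>x\<close>. Moving from \<open>x\<close> in the direction of the residual
  \<open>y = (K - m) x\<close> changes the form by \<open>2 t \<langle>y, y\<rangle>\<close> up to
  second order, so the residual has norm zero.\<close>

lemma psd_kernel_null:
  assumes fin: "finite V" and sym: "symmetric_on V K"
    and psd: "\<And>y. m * inner_on V y y \<le> inner_on V (kernel_map V K y) y"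
    and x: "inner_on V (kernel_map V K x) x = m * inner_on V x x"
    and i: "i \<in> V"
  shows "kernel_map V K x i = m * x i"
proof -
  define y where "y = (\<lambda>j. kernel_map V K x j - m * x j)"
  have "inner_on V y y = 0"
  proof (rule linear_coeff_zero_if_nonneg)
    fix t :: real
    let ?z = "\<lambda>i. x i + t * y i"
    have sw: "inner_on V (kernel_map V K y) x = inner_on V (kernel_map V K x) y"
      by (subst inner_on_kernel_map[OF sym]) (rule inner_on_commute)
    have yy: "inner_on V y y = inner_on V (kernel_map V K x) y - m * inner_on V x y"
      by (subst (1) y_def) (simp add: inner_on_diff_left inner_on_scale_left)
    have 1: "inner_on V (kernel_map V K ?z) ?z = inner_on V (kernel_map V K x) x
        + 2 * t * inner_on V (kernel_map V K x) y + t\<^sup>2 * inner_on V (kernel_map V K y) y"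
      by (simp add: kernel_map_add kernel_map_scale inner_on_bilinear sw algebra_simps power2_eq_square)
    have 2: "inner_on V ?z ?z = inner_on V x x + 2 * t * inner_on V x y + t\<^sup>2 * inner_on V y y"
      by (simp add: inner_on_bilinear inner_on_commute[of V y x] algebra_simps power2_eq_square)
    show "0 \<le> 2 * t * inner_on V y y
        + t\<^sup>2 * (inner_on V (kernel_map V K y) y - m * inner_on V y y)"
      using psd[of ?z] unfolding 1 2 x
      by (subst (1) yy) (simp add: algebra_simps)
  qed
  then show ?thesis
    using i fin by (simp add: inner_on_eq_0_iff y_def)
qed

text \<open>The form attains its minimum \<open>m\<close> on the compact sphere; homogeneity extends
  the bound to all \<open>y\<close>, and the first-order condition makes the minimiser an
  eigenvector.\<close>

lemma symmetric_kernel_min_eigenvector: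
  assumes fin: "finite V" and ne: "V \<noteq> {}" and sym: "symmetric_on V K"
  obtains x m where "inner_on V x x = 1" "\<And>i. i \<in> V \<Longrightarrow> kernel_map V K x i = m * x i"
    "\<And>y. m * inner_on V y y \<le> inner_on V (kernel_map V K y) y"
proof -
  let ?S = "{x. (\<forall>i. i \<notin> V \<longrightarrow> x i = 0) \<and> inner_on V x x = 1}"
  let ?Q = "\<lambda>x. inner_on V (kernel_map V K x) x"
  obtain v where "v \<in> V" using ne by blast
  let ?e = "\<lambda>i. if i = v then 1 else 0 :: real"
  have "inner_on V ?e ?e = (\<Sum>i\<in>V. if i = v then 1 else 0)"
    unfolding inner_on_def by (intro sum.cong) auto
  also have "\<dots> = 1"
    using fin \<open>v \<in> V\<close> by simp
  finally have "?e \<in> ?S"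
    using \<open>v \<in> V\<close> by auto
  then have "?S \<noteq> {}" by (metis empty_iff)
  moreover have "continuous_on UNIV ?Q"
    unfolding inner_on_def kernel_map_def
    by (intro continuous_intros continuous_on_product_coordinates)
  then have "continuous_on ?S ?Q" by (rule continuous_on_subset) simp
  ultimately have "\<exists>x\<in>?S. \<forall>y\<in>?S. ?Q x \<le> ?Q y"
    by (rule continuous_attains_inf[OF compact_unit_sphere_on[OF fin]])
  then obtain x where x: "x \<in> ?S" and min: "\<forall>y\<in>?S. ?Q x \<le> ?Q y" ..
  have psd: "?Q x * inner_on V y y \<le> ?Q y" for y
  proof (cases "inner_on V y y = 0")
    case True
    then show ?thesis
      using fin by (simp add: inner_on_eq_0_iff) (simp add: inner_on_def)
  next
    case False
    define c where "c = inverse (sqrt (inner_on V y y))"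
    have pos: "0 < inner_on V y y" using False inner_on_nonneg[of V y] by simp
    then have c: "c * (c * inner_on V y y) = 1"
      by (simp add: c_def field_simps)
    \<comment> \<open>Besides being normalised, \<open>y\<close> is cut off outside
      \<open>V\<close>, because the minimum was taken over functions vanishing there; neither form
      notices the cut.\<close>
    define z where "z = (\<lambda>i. if i \<in> V then c * y i else 0)"
    have zV: "inner_on V z u = c * inner_on V y u" for u
      unfolding z_def inner_on_scale_left[symmetric] by (rule inner_on_cong_left) simp
    have Kz: "kernel_map V K z = (\<lambda>i. c * kernel_map V K y i)"
      unfolding kernel_map_scale[symmetric] by (simp add: kernel_map_def z_def fun_eq_iff)
    have "inner_on V z z = 1"
      using c by (simp add: zV inner_on_commute[of V y z])
    then have "?Q x \<le> ?Q z"
      by (intro min[rule_format]) (simp add: z_def)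
    also have "?Q z = c * (c * ?Q y)"
      by (simp add: Kz inner_on_scale_left inner_on_commute[of V "kernel_map V K y" z] zV)
        (simp add: inner_on_commute[of V y])
    finally have "?Q x * inner_on V y y \<le> c * (c * ?Q y) * inner_on V y y"
      using pos by (intro mult_right_mono) auto
    also have "\<dots> = c * (c * inner_on V y y) * ?Q y" by (simp add: algebra_simps)
    also have "\<dots> = ?Q y" by (simp add: c)
    finally show ?thesis .
  qed
  show ?thesis
  proof (rule that[of x "?Q x"])
    show "inner_on V x x = 1" using x by simp
    then show "kernel_map V K x i = ?Q x * x i" if "i \<in> V" for i
      using psd_kernel_null[OF fin sym psd, of x] that by simp
  qed (rule psd)
qed

section \<open>Locating an eigenvalue of a symmetric kernel in a half-open interval\<close>

definition kernel_eigenvalue :: "'a set \<Rightarrow> ('a \<Rightarrow> 'a \<Rightarrow> 'b) \<Rightarrow> 'b :: comm_ring_1 \<Rightarrow> bool" where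
  "kernel_eigenvalue V K l \<longleftrightarrow>
     (\<exists>x. (\<exists>i\<in>V. x i \<noteq> 0) \<and> (\<forall>i\<in>V. kernel_map V K x i = l * x i))"

text \<open>
  The minimum \<open>m \<le> 0\<close> of the form of \<open>(K - p) (K - q)\<close> on the unit sphere is attained at some \<open>x\<close>
  with \<open>(K - p) (K - q) x = m x\<close>, which factors as \<open>(K - \<alpha>) (K - \<beta>) x = 0\<close> with
  \<open>p \<le> \<alpha> \<le> \<beta> \<le> q\<close>.  Only for \<open>m = 0\<close> can \<open>\<alpha> = p\<close> occur, and then \<open>w\<close> itself is a minimiser.
\<close>
lemma symmetric_kernel_eigenvalue_between:
  fixes p q :: real
  assumes fin: "finite V" and sym: "symmetric_on V K" and pq: "p < q"
    and w: "inner_on V (kernel_map V K w) (kernel_map V K w)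
      - (p + q) * inner_on V (kernel_map V K w) w + p * q * inner_on V w w \<le> 0"
    and nw: "\<exists>i\<in>V. kernel_map V K w i \<noteq> p * w i"
  shows "\<exists>l. p < l \<and> l \<le> q \<and> kernel_eigenvalue V K l"
proof -
  \<comment> \<open>\<open>M\<close> is the kernel of \<open>(K - p) (K - q)\<close>; the last
    summand is the diagonal \<open>p * q\<close>.\<close>
  define M where "M i j = (\<Sum>k\<in>V. K i k * K k j) - (p + q) * K i j
    + (if i = j then p * q else 0)" for i j
  have M: "kernel_map V M x i = kernel_map V K (kernel_map V K x) i - (p + q) * kernel_map V K x i
      + p * q * x i" if "i \<in> V" for x i
  proof -
    have "(\<Sum>j\<in>V. (\<Sum>k\<in>V. K i k * K k j) * x j) = (\<Sum>k\<in>V. \<Sum>j\<in>V. K i k * K k j * x j)"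
      unfolding sum_distrib_right by (rule sum.swap)
    also have "\<dots> = kernel_map V K (kernel_map V K x) i"
      by (simp add: kernel_map_def sum_distrib_left mult.assoc)
    finally have 1: "(\<Sum>j\<in>V. (\<Sum>k\<in>V. K i k * K k j) * x j) = kernel_map V K (kernel_map V K x) i" .
    have 2: "(\<Sum>j\<in>V. (if i = j then p * q else 0) * x j) = p * q * x i"
      using fin that by (simp add: if_distrib[of "\<lambda>z. z * _"] cong: if_cong)
    have "kernel_map V M x i = (\<Sum>j\<in>V. ((\<Sum>k\<in>V. K i k * K k j) * x j - (p + q) * (K i j * x j))
        + (if i = j then p * q else 0) * x j)"
      unfolding kernel_map_def M_def by (intro sum.cong refl) (simp only: ring_distribs mult.assoc)
    also have "\<dots> = (\<Sum>j\<in>V. (\<Sum>k\<in>V. K i k * K k j) * x j) - (p + q) * kernel_map V K x i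
        + (\<Sum>j\<in>V. (if i = j then p * q else 0) * x j)"
      unfolding kernel_map_def sum_distrib_left by (simp only: sum.distrib sum_subtractf)
    finally have "kernel_map V M x i = (\<Sum>j\<in>V. (\<Sum>k\<in>V. K i k * K k j) * x j)
        - (p + q) * kernel_map V K x i + (\<Sum>j\<in>V. (if i = j then p * q else 0) * x j)" .
    then show ?thesis by (simp only: 1 2)
  qed
  have symM: "symmetric_on V M"
  proof -
    have "(\<Sum>k\<in>V. K i k * K k j) = (\<Sum>k\<in>V. K j k * K k i)" if "i \<in> V" "j \<in> V" for i j
      using sym that unfolding symmetric_on_def by (intro sum.cong refl) (simp add: mult.commute)
    then show ?thesis
      using sym unfolding symmetric_on_def by (simp add: M_def)
  qed
  \<comment> \<open>Moving one factor \<open>K\<close> across the inner product turns the form of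
    \<open>M\<close> into the expression bounded in the hypothesis on \<open>w\<close>.\<close>
  have QM: "inner_on V (kernel_map V M x) x = inner_on V (kernel_map V K x) (kernel_map V K x)
      - (p + q) * inner_on V (kernel_map V K x) x + p * q * inner_on V x x" for x
  proof -
    have "inner_on V (kernel_map V M x) x = inner_on V (\<lambda>i. kernel_map V K (kernel_map V K x) i
        - (p + q) * kernel_map V K x i + p * q * x i) x"
      by (rule inner_on_cong_left) (simp add: M)
    then show ?thesis
      by (simp add: inner_on_add_left inner_on_diff_left inner_on_scale_left
          inner_on_kernel_map[OF sym, of "kernel_map V K x"])
  qed
  have ne: "V \<noteq> {}" using nw by blast
  obtain x m where x: "inner_on V x x = 1" "\<And>i. i \<in> V \<Longrightarrow> kernel_map V M x i = m * x i"
    and min: "\<And>y. m * inner_on V y y \<le> inner_on V (kernel_map V M y) y"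
    using symmetric_kernel_min_eigenvector[OF fin ne symM] by metis
  have Qw: "inner_on V (kernel_map V M w) w \<le> 0" using w by (simp only: QM)
  \<comment> \<open>If \<open>(K - a) (K - b) y = 0\<close>, then \<open>(K - a) y\<close> is either
    zero on \<open>V\<close> or an eigenvector for \<open>b\<close>, as the two factors
    commute.\<close>
  have eig: "(\<forall>i\<in>V. kernel_map V K y i = a * y i) \<or> kernel_eigenvalue V K b"
    if y: "\<And>i. i \<in> V \<Longrightarrow> kernel_map V K (kernel_map V K y) i
      - (a + b) * kernel_map V K y i + a * b * y i = 0" for y and a b :: real
  proof (cases "\<forall>i\<in>V. kernel_map V K y i = a * y i")
    case False
    let ?z = "\<lambda>i. kernel_map V K y i - a * y i"
    have "\<forall>i\<in>V. kernel_map V K ?z i = b * ?z i"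
      using y by (simp add: kernel_map_diff kernel_map_scale algebra_simps)
    moreover have "\<exists>i\<in>V. ?z i \<noteq> 0" using False by simp
    ultimately have "kernel_eigenvalue V K b"
      unfolding kernel_eigenvalue_def by (intro exI[of _ ?z] conjI)
    then show ?thesis ..
  qed simp
  have "inner_on V w w \<noteq> 0"
  proof
    assume "inner_on V w w = 0"
    then have "\<forall>i\<in>V. w i = 0" using fin by (simp add: inner_on_eq_0_iff)
    then show False using nw by (simp add: kernel_map_def)
  qed
  then have ww: "0 < inner_on V w w" using inner_on_nonneg[of V w] by simp
  have "m * inner_on V w w \<le> 0" using min[of w] Qw by simp
  then have "m \<le> 0" using ww by (simp add: mult_le_0_iff)
  show ?thesis
  proof (cases "m = 0")
    case True
    \<comment> \<open>With \<open>M\<close> positive semidefinite, the form at \<open>w\<close> is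
      squeezed to zero, so \<open>M w = 0\<close>. Since \<open>K w \<noteq> p w\<close>, the
      factorisation yields the eigenvalue \<open>q\<close>.\<close>
    then have "inner_on V (kernel_map V M w) w = m * inner_on V w w"
      using min[of w] Qw by simp
    then have "kernel_map V M w i = 0" if "i \<in> V" for i
      using psd_kernel_null[OF fin symM min] that True by fastforce
    then have "kernel_eigenvalue V K q"
      using eig[of w p q] nw M by auto
    then show ?thesis using pq by auto
  next
    case False
    \<comment> \<open>\<open>?a\<close> and \<open>?b\<close> below are the roots of
      \<open>(X - p) (X - q) = m\<close>, and \<open>h\<close> is half their distance.\<close>
    define h where "h = sqrt ((q - p)\<^sup>2 + 4 * m) / 2"
    let ?a = "(p + q) / 2 - h" and ?b = "(p + q) / 2 + h"
    let ?y = "\<lambda>i. kernel_map V K x i - (p + q) / 2 * x i"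
    \<comment> \<open>Completing the square:
      \<open>M = (K - (p + q) / 2)\<^sup>2 - (q - p)\<^sup>2 / 4\<close>, so \<open>m\<close> is at
      least \<open>- (q - p)\<^sup>2 / 4\<close> and the discriminant is nonnegative.\<close>
    have "inner_on V ?y ?y = inner_on V (kernel_map V M x) x + (q - p)\<^sup>2 / 4 * inner_on V x x"
      by (simp only: QM inner_on_bilinear inner_on_commute[of V x "kernel_map V K x"])
        (simp add: power2_eq_square field_simps)
    also have "inner_on V (kernel_map V M x) x = m * inner_on V x x"
      unfolding inner_on_scale_left[symmetric] by (rule inner_on_cong_left) (rule x(2))
    finally have D: "0 \<le> (q - p)\<^sup>2 + 4 * m"
      using inner_on_nonneg[of V ?y] x(1) by simp
    then have h2: "4 * (h * h) = (q - p)\<^sup>2 + 4 * m" and "0 \<le> h"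
      by (simp_all add: h_def)
    \<comment> \<open>Here \<open>m < 0\<close> strictly, which pushes both roots into the open
      interval between \<open>p\<close> and \<open>q\<close>.\<close>
    have "sqrt ((q - p)\<^sup>2 + 4 * m) < sqrt ((q - p)\<^sup>2)"
      using False \<open>m \<le> 0\<close> by (intro real_sqrt_less_mono) simp
    then have "2 * h < q - p" using pq by (simp add: h_def)
    have ab: "?a * ?b = p * q - m" "?a + ?b = p + q"
      using h2 by (auto simp: field_simps power2_eq_square)
    have "kernel_map V K (kernel_map V K x) i - (?a + ?b) * kernel_map V K x i + ?a * ?b * x i = 0"
      if "i \<in> V" for i
      unfolding ab using M[OF that, of x] x(2)[OF that] by (simp add: algebra_simps)
    then have "(\<forall>i\<in>V. kernel_map V K x i = ?a * x i) \<or> kernel_eigenvalue V K ?b"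
      by (rule eig)
    moreover have "\<exists>i\<in>V. x i \<noteq> 0"
      using x(1) inner_on_eq_0_iff[OF fin, of x] by auto
    ultimately have "kernel_eigenvalue V K ?a \<or> kernel_eigenvalue V K ?b"
      unfolding kernel_eigenvalue_def by blast
    moreover have "p < ?a" "?a \<le> q" "p < ?b" "?b \<le> q"
      using \<open>0 \<le> h\<close> \<open>2 * h < q - p\<close> by (auto simp: field_simps)
    ultimately show ?thesis by blast
  qed
qed

section \<open>Change of sign, change of scalars and passage to matrices\<close>

lemma kernel_eigenvalue_uminus:
  assumes "kernel_eigenvalue V (\<lambda>i j. - K i j) l"
  shows "kernel_eigenvalue V K (- l)"
proof -
  obtain x where x: "\<exists>i\<in>V. x i \<noteq> 0" "\<forall>i\<in>V. kernel_map V (\<lambda>i j. - K i j) x i = l * x i"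
    using assms unfolding kernel_eigenvalue_def by blast
  have "kernel_map V K x i = - kernel_map V (\<lambda>i j. - K i j) x i" for i
    by (simp add: kernel_map_def sum_negf)
  then have "\<forall>i\<in>V. kernel_map V K x i = - l * x i"
    using x(2) by simp
  with x(1) show ?thesis
    unfolding kernel_eigenvalue_def by (intro exI[of _ x] conjI)
qed

lemma kernel_eigenvalue_of_real:
  assumes "kernel_eigenvalue V K l"
  shows "kernel_eigenvalue V (\<lambda>i j. of_real (K i j) :: complex) (of_real l)"
proof -
  obtain x where x: "\<exists>i\<in>V. x i \<noteq> 0" "\<forall>i\<in>V. kernel_map V K x i = l * x i"
    using assms unfolding kernel_eigenvalue_def by blast
  let ?x = "\<lambda>i. of_real (x i) :: complex"
  have "kernel_map V (\<lambda>i j. of_real (K i j)) ?x i = of_real (kernel_map V K x i)" for i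
    by (simp add: kernel_map_def)
  then have "\<forall>i\<in>V. kernel_map V (\<lambda>i j. of_real (K i j)) ?x i = of_real l * ?x i"
    using x(2) by simp
  moreover have "\<exists>i\<in>V. ?x i \<noteq> 0" using x(1) by simp
  ultimately show ?thesis
    unfolding kernel_eigenvalue_def by (intro exI[of _ ?x] conjI)
qed

definition adjacency :: "'a pair_pre_digraph \<Rightarrow> 'a \<Rightarrow> 'a \<Rightarrow> 'b :: zero_neq_one" where
  "adjacency G u v = (if (u, v) \<in> parcs G then 1 else 0)"

text \<open>Listing the eigenfunction along \<open>xs\<close> gives an eigenvector, since the
  indices of \<open>xs\<close> biject with the vertices. One kernel eigenvalue thus serves every
  vertex ordering.\<close>

lemma eigenvalue_adj_matrix:
  fixes l :: "'b :: comm_ring_1"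
  assumes xs: "vertex_ordering G xs" and l: "kernel_eigenvalue (pverts G) (adjacency G) l"
  shows "eigenvalue (adj_matrix G xs) l"
proof -
  obtain x where x: "\<exists>u\<in>pverts G. x u \<noteq> 0"
    "\<forall>u\<in>pverts G. kernel_map (pverts G) (adjacency G) x u = l * x u"
    using l unfolding kernel_eigenvalue_def by blast
  let ?n = "length xs" and ?v = "vec (length xs) (\<lambda>i. x (xs ! i))"
  have V: "set xs = pverts G" "distinct xs"
    using xs by (auto simp: vertex_ordering_def)
  have "adj_matrix G xs *\<^sub>v ?v = l \<cdot>\<^sub>v ?v"
  proof (rule eq_vecI)
    fix i assume "i < dim_vec (l \<cdot>\<^sub>v ?v)"
    then have i: "i < ?n" by simp
    then have "(adj_matrix G xs *\<^sub>v ?v) $ i = (\<Sum>j<?n. adjacency G (xs ! i) (xs ! j) * x (xs ! j))"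
      by (simp add: adj_matrix_def adjacency_def scalar_prod_def lessThan_atLeast0)
    also have "\<dots> = kernel_map (pverts G) (adjacency G) x (xs ! i)"
      unfolding kernel_map_def
      by (rule sum.reindex_bij_betw) (simp add: V bij_betw_nth)
    also have "\<dots> = l * x (xs ! i)" using x(2) V i by (metis nth_mem)
    finally show "(adj_matrix G xs *\<^sub>v ?v) $ i = (l \<cdot>\<^sub>v ?v) $ i" using i by simp
  qed (simp add: adj_matrix_def)
  moreover have "?v \<noteq> 0\<^sub>v ?n"
  proof -
    obtain i where i: "i < ?n" "x (xs ! i) \<noteq> 0"
      using x(1) V by (metis in_set_conv_nth)
    then have "?v $ i \<noteq> 0\<^sub>v ?n $ i" by simp
    then show ?thesis by metis
  qed
  ultimately show ?thesis
    unfolding eigenvalue_def eigenvector_def by (auto simp: adj_matrix_def intro!: exI[of _ ?v])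
qed

section \<open>The quadratic form at the end of a pendant path\<close>

text \<open>The cubic is the triple-angle formula at \<open>pi / 9\<close>, where
  \<open>cos (pi / 3) = 1 / 2\<close>. The bound \<open>r < 2\<close> later excludes integers from
  the interval.\<close>

lemma two_cos_pi_9:
  fixes r :: real
  defines "r \<equiv> 2 * cos (pi / 9)"
  shows "r ^ 3 = 3 * r + 1" and "1 < r" and "r < 2"
proof -
  have "cos (3 * (pi / 9)) = 4 * cos (pi / 9) ^ 3 - 3 * cos (pi / 9)"
    by (rule cos_treble_cos)
  moreover have "cos (3 * (pi / 9)) = 1 / 2" using cos_60 by simp
  ultimately show "r ^ 3 = 3 * r + 1" by (simp add: r_def power_mult_distrib)
  have "cos (pi / 3) < cos (pi / 9)" by (rule cos_monotone_0_pi) auto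
  then show "1 < r" by (simp add: r_def cos_60)
  have "cos (pi / 9) < cos 0" by (rule cos_monotone_0_pi) auto
  then show "r < 2" by (simp add: r_def)
qed

text \<open>The sign \<open>s\<close> lets one argument treat both \<open>A\<close> and
  \<open>- A\<close>. The row of \<open>d\<close> is left free, since the neighbours of
  \<open>d\<close> away from the path end are unknown.\<close>

lemma path_end_kernel_eigenvalue:
  fixes K :: "'a \<Rightarrow> 'a \<Rightarrow> real"
  assumes fin: "finite V" and sym: "symmetric_on V K" and s: "s * s = 1"
    and V: "a \<in> V" "b \<in> V" "c \<in> V" "d \<in> V" and dist: "distinct [a, b, c, d]"
    and Ka: "\<And>j. j \<in> V \<Longrightarrow> K a j = (if j = b then s else 0)"
    and Kb: "\<And>j. j \<in> V \<Longrightarrow> K b j = (if j = a \<or> j = c then s else 0)"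
    and Kc: "\<And>j. j \<in> V \<Longrightarrow> K c j = (if j = b \<or> j = d then s else 0)"
  shows "\<exists>l. 1 < l \<and> l \<le> 2 * cos (pi / 9) \<and> kernel_eigenvalue V K l"
proof -
  define r :: real where "r = 2 * cos (pi / 9)"
  have r: "r ^ 3 = 3 * r + 1" "1 < r"
    using two_cos_pi_9 by (simp_all add: r_def)
  \<comment> \<open>the null vector of the form of \<open>(K - 1) (K - \<rho>)\<close> restricted to \<open>{a, b, c}\<close>\<close>
  define w where "w = (\<lambda>i. if i = a then 1 + r else if i = b then s * r\<^sup>2 else if i = c then r else 0)"
  have supp: "(\<Sum>i\<in>V. f i) = f a + f b + f c + f d"
    if "\<And>i. i \<in> V - {a, b, c, d} \<Longrightarrow> f i = 0" for f :: "'a \<Rightarrow> real"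
  proof -
    have "(\<Sum>i\<in>V. f i) = (\<Sum>i\<in>{a, b, c, d}. f i)"
      using fin V that by (intro sum.mono_neutral_right) auto
    then show ?thesis using dist by simp
  qed
  \<comment> \<open>Symmetry replaces the columns of \<open>a\<close>, \<open>b\<close>,
    \<open>c\<close> by their rows, which are known; this gives \<open>K w\<close> even at
    \<open>d\<close>.\<close>
  have Kw: "kernel_map V K w i = K a i * (1 + r) + K b i * (s * r\<^sup>2) + K c i * r" if "i \<in> V" for i
  proof -
    have "kernel_map V K w i = K i a * (1 + r) + K i b * (s * r\<^sup>2) + K i c * r"
      unfolding kernel_map_def using dist by (subst supp) (auto simp: w_def)
    then show ?thesis using sym V that by (simp add: symmetric_on_def)
  qed
  have ne: "a \<noteq> b" "a \<noteq> c" "a \<noteq> d" "b \<noteq> c" "b \<noteq> d" "c \<noteq> d"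
    "b \<noteq> a" "c \<noteq> a" "d \<noteq> a" "c \<noteq> b" "d \<noteq> b" "d \<noteq> c"
    using dist by auto
  have ss: "s * (s * x) = x" for x
    using s by (metis mult.assoc mult_1)
  have vals: "kernel_map V K w a = r\<^sup>2" "kernel_map V K w b = s * (1 + 2 * r)"
    "kernel_map V K w c = r\<^sup>2" "kernel_map V K w d = s * r"
    using ne V by (simp_all add: Kw Ka Kb Kc ss) (simp_all add: algebra_simps)
  have w: "w a = 1 + r" "w b = s * r\<^sup>2" "w c = r" "w d = 0"
    using dist by (auto simp: w_def)
  have zero: "kernel_map V K w i = 0" "w i = 0" if "i \<in> V - {a, b, c, d}" for i
    using that by (auto simp: Kw Ka Kb Kc) (auto simp: w_def)
  have 1: "inner_on V (kernel_map V K w) (kernel_map V K w) = 2 * r ^ 4 + (1 + 2 * r)\<^sup>2 + r\<^sup>2"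
    unfolding inner_on_def
    by (subst supp) (simp_all add: zero vals w, simp add: power2_eq_square power3_eq_cube power4_eq_xxxx algebra_simps s ss)
  have 2: "inner_on V (kernel_map V K w) w = 2 * r\<^sup>2 + 4 * r ^ 3"
    unfolding inner_on_def
    by (subst supp) (simp_all add: zero vals w, simp add: power2_eq_square power3_eq_cube power4_eq_xxxx algebra_simps s ss)
  have 3: "inner_on V w w = (1 + r)\<^sup>2 + r ^ 4 + r\<^sup>2"
    unfolding inner_on_def
    by (subst supp) (simp_all add: zero vals w, simp add: power2_eq_square power3_eq_cube power4_eq_xxxx algebra_simps s ss)
  \<comment> \<open>The form of \<open>(K - 1) (K - r)\<close> at \<open>w\<close> contains the
    factor \<open>r ^ 3 - (3 * r + 1)\<close>, which vanishes for
    \<open>r = 2 * cos (pi / 9)\<close>.\<close>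
  have "2 * r ^ 4 + (1 + 2 * r)\<^sup>2 + r\<^sup>2 - (1 + r) * (2 * r\<^sup>2 + 4 * r ^ 3)
      + 1 * r * ((1 + r)\<^sup>2 + r ^ 4 + r\<^sup>2) = (r ^ 3 - (3 * r + 1)) * (r\<^sup>2 - 2 * r - 1)"
    by (simp add: power2_eq_square power3_eq_cube power4_eq_xxxx algebra_simps)
  then have "inner_on V (kernel_map V K w) (kernel_map V K w)
      - (1 + r) * inner_on V (kernel_map V K w) w + 1 * r * inner_on V w w \<le> 0"
    unfolding 1 2 3 r(1) by simp
  \<comment> \<open>At \<open>d\<close> the vector \<open>w\<close> is zero but \<open>K w\<close>
    is \<open>s * r\<close>, so \<open>w\<close> is not an eigenvector for 1.\<close>
  moreover have "kernel_map V K w d \<noteq> 1 * w d"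
    using s r(2) by (auto simp: vals w)
  ultimately show ?thesis
    using symmetric_kernel_eigenvalue_between[OF fin sym r(2), of w] V(4) unfolding r_def by blast
qed

section \<open>Graphs with a pendant path of length at least three\<close>

text \<open>As many neighbours are known as the degree allows, so there are no others.\<close>

lemma arc_iff_if_out_degree:
  assumes "finite (parcs G)" and "finite S" and "out_degree (with_proj G) u = card S"
    and "\<And>v. v \<in> S \<Longrightarrow> (u, v) \<in> parcs G"
  shows "(u, v) \<in> parcs G \<longleftrightarrow> v \<in> S"
proof -
  have "Pair u ` S \<subseteq> out_arcs (with_proj G) u" using assms(4) by auto
  moreover have "finite (out_arcs (with_proj G) u)"
    using assms(1) by (simp add: out_arcs_def)
  moreover have "card (Pair u ` S) = card (out_arcs (with_proj G) u)"
    using assms(3) by (simp add: out_degree_def card_image inj_on_def)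
  ultimately have "Pair u ` S = out_arcs (with_proj G) u"
    by (simp add: card_subset_eq)
  moreover have "(u, v) \<in> out_arcs (with_proj G) u \<longleftrightarrow> (u, v) \<in> parcs G" by simp
  ultimately have "(u, v) \<in> parcs G \<longleftrightarrow> (u, v) \<in> Pair u ` S" by simp
  then show ?thesis by (simp add: image_iff)
qed

lemma pendant_path_end:
  assumes G: "pair_graph G" and p: "pendant_path G v us" and len: "3 \<le> length us"
  obtains a b c d where "distinct [a, b, c, d]" "{a, b, c, d} \<subseteq> pverts G"
    "\<And>x. (a, x) \<in> parcs G \<longleftrightarrow> x = b" "\<And>x. (b, x) \<in> parcs G \<longleftrightarrow> x = a \<or> x = c"
    "\<And>x. (c, x) \<in> parcs G \<longleftrightarrow> x = b \<or> x = d"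
proof -
  interpret pair_graph G by (rule G)
  have "length (drop (length us - 3) us) = Suc (Suc (Suc 0))" using len by simp
  then obtain c b a where "drop (length us - 3) us = [c, b, a]"
    by (auto simp: length_Suc_conv simp del: length_drop)
  then obtain ys where us: "us = ys @ [c, b, a]" by (metis append_take_drop_id)
  \<comment> \<open>The vertex before \<open>c\<close>; it is \<open>v\<close> itself when the path
    has length exactly 3.\<close>
  define d where "d = last (v # ys)"
  have path: "set ((v # ys) @ [c, b, a]) \<subseteq> pverts G" "distinct ((v # ys) @ [c, b, a])"
    "set (vwalk_arcs ((v # ys) @ [c, b, a])) \<subseteq> parcs G"
    using p unfolding pendant_path_def us vpath_def vwalk_def by auto
  have "(d, c) \<in> parcs G" "(c, b) \<in> parcs G" "(b, a) \<in> parcs G"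
    using path(3) by (subst (asm) vwalk_arcs_append; simp add: d_def)+
  moreover have sy: "(y, x) \<in> parcs G" if "(x, y) \<in> parcs G" for x y
    using pair_sym_arcs that by (auto simp: symmetric_def dest: symD)
  ultimately have arcs: "(a, b) \<in> parcs G" "(b, a) \<in> parcs G" "(b, c) \<in> parcs G"
    "(c, b) \<in> parcs G" "(c, d) \<in> parcs G" by auto
  have "d \<in> set (v # ys)" unfolding d_def by (rule last_in_set) simp
  then have dist: "distinct [a, b, c, d]" and sub: "{a, b, c, d} \<subseteq> pverts G"
    using path(1,2) by auto
  have deg: "out_degree (with_proj G) a = card {b}" "out_degree (with_proj G) b = card {a, c}"
    "out_degree (with_proj G) c = card {b, d}"
    using p dist unfolding pendant_path_def us by (auto simp: butlast_append)
  show ?thesis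
    using arc_iff_if_out_degree[OF pair_finite_arcs _ deg(1)]
      arc_iff_if_out_degree[OF pair_finite_arcs _ deg(2)]
      arc_iff_if_out_degree[OF pair_finite_arcs _ deg(3)] arcs
    by (intro that[OF dist sub]) auto
qed

lemma pendant_path_kernel_eigenvalues:
  fixes G :: "'a pair_pre_digraph"
  assumes G: "pair_graph G" and p: "pendant_path G v us" "3 \<le> length us"
  shows "\<exists>l :: real. 1 < l \<and> l \<le> 2 * cos (pi / 9) \<and> kernel_eigenvalue (pverts G) (adjacency G) l"
    and "\<exists>l :: real. - (2 * cos (pi / 9)) \<le> l \<and> l < - 1 \<and> kernel_eigenvalue (pverts G) (adjacency G) l"
proof -
  interpret pair_graph G by (rule G)
  obtain a b c d where dist: "distinct [a, b, c, d]" and V: "{a, b, c, d} \<subseteq> pverts G"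
    and nbs: "\<And>x. (a, x) \<in> parcs G \<longleftrightarrow> x = b" "\<And>x. (b, x) \<in> parcs G \<longleftrightarrow> x = a \<or> x = c"
      "\<And>x. (c, x) \<in> parcs G \<longleftrightarrow> x = b \<or> x = d"
    using pendant_path_end[OF G p] by blast
  have "(x, y) \<in> parcs G \<longleftrightarrow> (y, x) \<in> parcs G" for x y
    using pair_sym_arcs by (auto simp: symmetric_def dest: symD)
  then have sym: "symmetric_on (pverts G) (\<lambda>u v. s * adjacency G u v)" for s
    by (simp add: symmetric_on_def adjacency_def)
  \<comment> \<open>\<open>s = 1\<close> gives the positive eigenvalue; \<open>s = - 1\<close> gives
    an eigenvalue of \<open>- A\<close>, whose negative is the other one.\<close>
  have *: "\<exists>l. 1 < l \<and> l \<le> 2 * cos (pi / 9)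
      \<and> kernel_eigenvalue (pverts G) (\<lambda>u v. s * adjacency G u v) l" if "s * s = 1" for s :: real
    by (rule path_end_kernel_eigenvalue[OF pair_finite_verts sym that _ _ _ _ dist])
      (use V in \<open>auto simp: adjacency_def nbs\<close>)
  show "\<exists>l :: real. 1 < l \<and> l \<le> 2 * cos (pi / 9) \<and> kernel_eigenvalue (pverts G) (adjacency G) l"
    using *[of 1] by simp
  obtain l where "1 < l" "l \<le> 2 * cos (pi / 9)"
    "kernel_eigenvalue (pverts G) (\<lambda>u v. - adjacency G u v) l"
    using *[of "- 1"] by auto
  then show "\<exists>l :: real. - (2 * cos (pi / 9)) \<le> l \<and> l < - 1
      \<and> kernel_eigenvalue (pverts G) (adjacency G) l"
    by (intro exI[of _ "- l"]) (auto intro: kernel_eigenvalue_uminus)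
qed

text \<open>The eigenvalue in \<open>(1, \<rho>]\<close> lies strictly between 1 and 2. It is viewed
  as a complex number because \<open>integral_graph\<close> quantifies over complex
  eigenvalues.\<close>

lemma pendant_path_not_integral:
  fixes G :: "'a pair_pre_digraph"
  assumes G: "pair_graph G" and p: "pendant_path G v us" "3 \<le> length us"
  shows "\<not> integral_graph G"
proof
  assume int: "integral_graph G"
  interpret pair_graph G by (rule G)
  obtain l :: real where l: "1 < l" "l \<le> 2 * cos (pi / 9)"
    and ev: "kernel_eigenvalue (pverts G) (adjacency G) l"
    using pendant_path_kernel_eigenvalues(1)[OF G p] by blast
  have "(\<lambda>u v. of_real (adjacency G u v)) = (adjacency G :: _ \<Rightarrow> _ \<Rightarrow> complex)"
    by (simp add: fun_eq_iff adjacency_def)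
  then have "kernel_eigenvalue (pverts G) (adjacency G) (of_real l :: complex)"
    using kernel_eigenvalue_of_real[OF ev] by simp
  moreover obtain xs where "vertex_ordering G xs"
    using finite_distinct_list[OF pair_finite_verts] unfolding vertex_ordering_def by blast
  ultimately have "complex_of_real l \<in> \<int>"
    using int eigenvalue_adj_matrix unfolding integral_graph_def by blast
  then obtain k where "complex_of_real l = of_int k" by (auto elim: Ints_cases)
  then have "l = of_int k" by (metis of_real_eq_iff of_real_of_int_eq)
  then have "1 < k" "k < 2" using l two_cos_pi_9(3) by linarith+
  then show False by simp
qed

section \<open>Cycles with attached paths\<close>

lemma vwalk_arcs_in_set:
  assumes "(x, y) \<in> set (vwalk_arcs p)"
  shows "x \<in> set p" "y \<in> set p"
  using assms by (induction p rule: vwalk_arcs.induct) auto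

lemma vwalk_arcs_irrefl:
  assumes "distinct p"
  shows "(x, x) \<notin> set (vwalk_arcs p)"
  using assms by (induction p rule: vwalk_arcs.induct) auto

lemma sym_undirected_arcs: "sym (undirected_arcs p)"
  by (auto simp: undirected_arcs_def sym_def)

lemma undirected_arcs_subset: "undirected_arcs p \<subseteq> set p \<times> set p"
  using vwalk_arcs_in_set[of _ _ p] unfolding undirected_arcs_def by fast

lemma pair_graphI:
  assumes "finite (pverts G)" "parcs G \<subseteq> pverts G \<times> pverts G" "sym (parcs G)"
    "\<And>x. (x, x) \<notin> parcs G"
  shows "pair_graph G"
proof
  show "finite (parcs G)" using assms(1,2) by (meson finite_SigmaI finite_subset)
  show "symmetric (with_proj G)" using assms(3) by (simp add: symmetric_def)
  show "fst e \<noteq> snd e" if "e \<in> parcs G" for e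
    using assms(4) that by (metis prod.collapse)
qed (use assms in auto)

lemma pair_graph_cycle_graph:
  assumes "3 \<le> length cs" "distinct cs"
  shows "pair_graph (cycle_graph cs)"
proof (rule pair_graphI)
  have ne: "cs \<noteq> []" using assms by auto
  \<comment> \<open>The arc closing the cycle is not a loop.\<close>
  have "hd cs \<noteq> last cs"
    using assms by (cases cs) auto
  moreover have "set (vwalk_arcs (cs @ [hd cs])) = insert (last cs, hd cs) (set (vwalk_arcs cs))"
    by (rule set_vwalk_arcs_snoc[OF ne])
  ultimately show "(x, x) \<notin> parcs (cycle_graph cs)" for x
    using vwalk_arcs_irrefl[OF assms(2)] by (auto simp: cycle_graph_def undirected_arcs_def)
  have "undirected_arcs (cs @ [hd cs]) \<subseteq> set cs \<times> set cs"
    using undirected_arcs_subset[of "cs @ [hd cs]"] ne by (simp add: insert_absorb)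
  then show "parcs (cycle_graph cs) \<subseteq> pverts (cycle_graph cs) \<times> pverts (cycle_graph cs)"
    by (simp add: cycle_graph_def)
  show "sym (parcs (cycle_graph cs))"
    by (simp add: cycle_graph_def sym_undirected_arcs)
qed (simp add: cycle_graph_def)

lemma pair_graph_attach_path:
  assumes G: "pair_graph G" and v: "v \<in> pverts G" and us: "distinct us" "set us \<inter> pverts G = {}"
  shows "pair_graph (attach_path G v us)"
proof -
  interpret pair_graph G by (rule G)
  have dist: "distinct (v # us)" using v us by auto
  show ?thesis
  proof (rule pair_graphI)
    show "finite (pverts (attach_path G v us))"
      by (simp add: attach_path_def pair_finite_verts)
    show "parcs (attach_path G v us) \<subseteq> pverts (attach_path G v us) \<times> pverts (attach_path G v us)"
      using v undirected_arcs_subset[of "v # us"] in_arcsD1 in_arcsD2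
      by (fastforce simp: attach_path_def)
    show "sym (parcs (attach_path G v us))"
      using pair_sym_arcs by (simp add: attach_path_def symmetric_def sym_Un sym_undirected_arcs)
    show "(x, x) \<notin> parcs (attach_path G v us)" for x
      using pair_no_loops[of "(x, x)"] vwalk_arcs_irrefl[OF dist, of x]
      by (auto simp: attach_path_def undirected_arcs_def)
  qed
qed

text \<open>By distinctness \<open>u\<close> occurs in no arc within \<open>ps\<close> or within
  \<open>qs\<close>, so only the arcs joining it to these two pieces remain. Used to compute degrees
  along an attached path.\<close>

lemma undirected_arcs_neighbours:
  assumes dist: "distinct (ps @ u # qs)" and ne: "ps \<noteq> []"
  shows "{x. (u, x) \<in> undirected_arcs (ps @ u # qs)} = insert (last ps) (if qs = [] then {} else {hd qs})"
proof -
  have "set (vwalk_arcs (ps @ u # qs)) = set (vwalk_arcs ps) \<union> {(last ps, u)} \<union> set (vwalk_arcs (u # qs))"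
    using ne by (simp add: vwalk_arcs_append)
  moreover have "set (vwalk_arcs (u # qs)) = (if qs = [] then {} else {(u, hd qs)}) \<union> set (vwalk_arcs qs)"
    by (cases qs) auto
  ultimately show ?thesis
    using dist ne by (auto simp: undirected_arcs_def dest: vwalk_arcs_in_set split: if_splits)
qed

lemma out_degree_card_neighbours: "out_degree (with_proj G) u = card {x. (u, x) \<in> parcs G}"
proof -
  have "out_arcs (with_proj G) u = Pair u ` {x. (u, x) \<in> parcs G}" by auto
  then show ?thesis by (simp add: out_degree_def card_image inj_on_def)
qed

text \<open>The new vertices carry no arc of \<open>G\<close>, so their degrees are those in the
  path \<open>v # us\<close> alone.\<close>

lemma pendant_path_attach_path:
  assumes G: "pair_graph G" and v: "v \<in> pverts G"
    and us: "us \<noteq> []" "distinct us" "set us \<inter> pverts G = {}"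
  shows "pendant_path (attach_path G v us) v us"
proof -
  interpret pair_graph G by (rule G)
  have dist: "distinct (v # us)" using v us by auto
  have nbs: "{x. (u, x) \<in> parcs (attach_path G v us)} = {x. (u, x) \<in> undirected_arcs (v # us)}"
    if "u \<in> set us" for u
    using that us(3) by (auto simp: attach_path_def dest: in_arcsD1)
  have "out_degree (with_proj (attach_path G v us)) u = 2" if u: "u \<in> set (butlast us)" for u
  proof -
    obtain ys zs where "butlast us = ys @ u # zs" using u by (meson split_list)
    then have eq: "v # us = (v # ys) @ u # (zs @ [last us])"
      using us(1) by (metis append_Cons append_assoc append_butlast_last_id)
    have "out_degree (with_proj (attach_path G v us)) u
        = card {last (v # ys), hd (zs @ [last us])}"
      unfolding out_degree_card_neighbours nbs[OF in_set_butlastD[OF u]] eq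
      by (subst undirected_arcs_neighbours[OF dist[unfolded eq]]) auto
    \<comment> \<open>Predecessor and successor lie in disjoint pieces of the path, so the
      two-element set really has two elements.\<close>
    moreover have "last (v # ys) \<in> set (v # ys)" "hd (zs @ [last us]) \<in> set (zs @ [last us])"
      by (rule last_in_set hd_in_set; simp)+
    then have "last (v # ys) \<noteq> hd (zs @ [last us])"
      using dist unfolding eq by (metis disjoint_iff distinct_append list.set_intros(2))
    ultimately show ?thesis by simp
  qed
  moreover have "out_degree (with_proj (attach_path G v us)) (last us) = 1"
  proof -
    have eq: "v # us = (v # butlast us) @ last us # []" using us(1) by simp
    have "{x. (last us, x) \<in> undirected_arcs (v # us)} = {last (v # butlast us)}"
      unfolding eq by (subst undirected_arcs_neighbours[OF dist[unfolded eq]]) auto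
    then show ?thesis
      using nbs us(1) by (simp add: out_degree_card_neighbours)
  qed
  moreover have "vpath (v # us) (with_proj (attach_path G v us))"
    using dist v by (auto simp: vpath_def vwalk_def attach_path_def undirected_arcs_def)
  ultimately show ?thesis using us(1) by (auto simp: pendant_path_def)
qed

text \<open>New arcs touch only \<open>v\<close> and the fresh vertices, none of which lies in
  \<open>ys\<close>, so degrees along \<open>ys\<close> are unchanged. The case \<open>x = v\<close>
  is included: several paths may share a cycle vertex.\<close>

lemma pendant_path_attach_path_other:
  assumes "pendant_path G x ys" and "v \<notin> set ys" and "set us \<inter> pverts G = {}"
  shows "pendant_path (attach_path G v us) x ys"
proof -
  have "set (x # ys) \<subseteq> pverts G"
    using assms(1) by (auto simp: pendant_path_def vpath_def vwalk_def)
  then have "u \<notin> set (v # us)" if "u \<in> set ys" for u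
    using assms(2,3) that by auto
  then have "(u, w) \<notin> undirected_arcs (v # us)" if "u \<in> set ys" for u w
    using undirected_arcs_subset[of "v # us"] that by blast
  then have "out_degree (with_proj (attach_path G v us)) u = out_degree (with_proj G) u"
    if "u \<in> set ys" for u
    using that by (simp add: out_degree_card_neighbours attach_path_def)
  moreover have "vpath (x # ys) (with_proj (attach_path G v us))"
    using assms(1) by (auto simp: pendant_path_def vpath_def vwalk_def attach_path_def)
  ultimately show ?thesis
    using assms(1) by (simp add: pendant_path_def in_set_butlastD)
qed

text \<open>The induction carries along that attached paths avoid the cycle: later paths start at
  cycle vertices and therefore leave the degrees on earlier paths intact.\<close>

lemma generalized_sun_pendant_paths:
  assumes "generalized_sun cs ps G"
  shows "pair_graph G \<and> set cs \<subseteq> pverts G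
    \<and> (\<forall>(v, us) \<in> set ps. pendant_path G v us \<and> set us \<inter> set cs = {})"
  using assms
proof induction
  case cycle
  then show ?case by (simp add: pair_graph_cycle_graph) (simp add: cycle_graph_def)
next
  case (attach ps G v us)
  then have IH: "pair_graph G" "set cs \<subseteq> pverts G"
    "\<And>x ys. (x, ys) \<in> set ps \<Longrightarrow> pendant_path G x ys \<and> set ys \<inter> set cs = {}" by auto
  have v: "v \<in> pverts G" using attach IH(2) by auto
  have "pendant_path (attach_path G v us) x ys" if "(x, ys) \<in> set ps" for x ys
    using IH(3)[OF that] attach by (intro pendant_path_attach_path_other) auto
  moreover have "set us \<inter> set cs = {}" using attach IH(2) by blast
  ultimately show ?case
    using pair_graph_attach_path[OF IH(1) v] pendant_path_attach_path[OF IH(1) v] attach IH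
    by (auto simp: attach_path_def)
qed

theorem theorem2p1:
  shows "(\<forall>G :: 'a pair_pre_digraph.
            pair_graph G \<and> (\<exists>v us. pendant_path G v us \<and> 3 \<le> length us) \<longrightarrow>
            (\<forall>xs. vertex_ordering G xs \<longrightarrow>
               (\<exists>x :: real. 1 < x \<and> x \<le> 2 * cos (pi / 9) \<and> eigenvalue (adj_matrix G xs) x) \<and>
               (\<exists>x :: real. - (2 * cos (pi / 9)) \<le> x \<and> x < - 1 \<and> eigenvalue (adj_matrix G xs) x)) \<and>
            \<not> integral_graph G) \<and>
         \<not> (\<exists>(G :: 'a pair_pre_digraph) cs ps v us.
              generalized_sun cs ps G \<and> (v, us) \<in> set ps \<and> 3 \<le> length us \<and> integral_graph G)"
proof (intro conjI allI impI notI; elim conjE exE)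
  fix G :: "'a pair_pre_digraph" and xs v us
  assume G: "pair_graph G" "pendant_path G v us" "3 \<le> length us"
  show "integral_graph G \<Longrightarrow> False"
    using pendant_path_not_integral[OF G] by simp
  assume xs: "vertex_ordering G xs"
  show "\<exists>x :: real. 1 < x \<and> x \<le> 2 * cos (pi / 9) \<and> eigenvalue (adj_matrix G xs) x"
    using pendant_path_kernel_eigenvalues(1)[OF G] eigenvalue_adj_matrix[OF xs] by blast
  show "\<exists>x :: real. - (2 * cos (pi / 9)) \<le> x \<and> x < - 1 \<and> eigenvalue (adj_matrix G xs) x"
    using pendant_path_kernel_eigenvalues(2)[OF G] eigenvalue_adj_matrix[OF xs] by blast
next
  fix G :: "'a pair_pre_digraph" and cs ps v us
  assume sun: "generalized_sun cs ps G" "(v, us) \<in> set ps"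
    and "3 \<le> length us" "integral_graph G"
  have "pair_graph G" "pendant_path G v us"
    using generalized_sun_pendant_paths[OF sun(1)] sun(2) by auto
  then show False
    using pendant_path_not_integral[of G v us] \<open>3 \<le> length us\<close> \<open>integral_graph G\<close> by simp
qed

end
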